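(* Let $\mathfrak{C}$ be a finite cyclic group acting on a graph $G$ such that the vertex $x$ is a fixed point of the action. Fix a positive integer $k$. Suppose that we have polynomials $a(q)$ and $b(q)$ such that $(\mathcal{I}_k(G\setminus x),\mathfrak{C},a(q))$ and $(\mathcal{I}_{k-1}(G\setminus N[x]),\mathfrak{C},b(q))$ both exhibit the cyclic sieving phenomenon. Then $(\mathcal{I}_k(G),\mathfrak{C},a(q)+b(q))$ also exhibits the cyclic sieving phenomenon.
   Context: All graphs are finite and simple. $\mathcal{I}_k(G)$ is the collection of independent sets of size $k$ of $G$. A group acts on a graph if it acts on its vertex set preserving the adjacency relation; it then acts on $\mathcal{I}_k(G)$ by $\mathfrak{g}S=\{\mathfrak{g}v:v\in S\}$. $N[x]=\{v:v\sim x\}\cup\{x\}$ is the closed neighborhood of $x$; $G\setminus x$ and $G\setminus N[x]$ denote the graphs obtained by deleting the vertex $x$, respectively all vertices of $N[x]$. When $x$ is fixed by $\mathfrak{C}$, the group $\mathfrak{C}$ acts by restriction on both $G\setminus x$ and $G\setminus N[x]$. Cyclic sieving phenomenon (CSP): for a finite cyclic group $\mathfrak{C}$, a finite set $X$ and a polynomial $f(q)$, the triple $(X,\mathfrak{C},f(q))$ exhibits the CSP if $\mathfrak{C}$ acts on $X$ and for every $\mathfrak{g}\in\mathfrak{C}$ of order $d$ and every primitive $d$th root of unity $\omega\in\mathbb{C}$ we have $|X^{\mathfrak{g}}|=f(\omega)$, where $X^{\mathfrak{g}}=\{x\in X:\mathfrak{g}x=x\}$. *)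

theory Defs
  imports
    Complex_Main
    "HOL-Computational_Algebra.Polynomial"
    "HOL-Algebra.Elementary_Groups"
    "HOL-Algebra.Multiplicative_Group"
    "HOL-Algebra.Group_Action"
    "Graph_Theory.Digraph_Component"
begin

text \<open>
  Finite simple graphs are those of the locale \<^locale>\<open>graph\<close>: finite, loopless, symmetric
  digraphs without parallel arcs. An undirected edge is a pair of opposite arcs.
\<close>

definition closed_nbhd :: "('a, 'b) pre_digraph \<Rightarrow> 'a \<Rightarrow> 'a set" where
  "closed_nbhd G x = {v \<in> verts G. v \<rightarrow>\<^bsub>G\<^esub> x} \<union> {x}"

definition delete_verts :: "('a, 'b) pre_digraph \<Rightarrow> 'a set \<Rightarrow> ('a, 'b) pre_digraph" where
  "delete_verts G U = G \<restriction> (verts G - U)"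

definition indep_sets :: "nat \<Rightarrow> ('a, 'b) pre_digraph \<Rightarrow> 'a set set" where
  "indep_sets k G = {S. S \<subseteq> verts G \<and> card S = k \<and> (\<forall>u\<in>S. \<forall>v\<in>S. \<not> u \<rightarrow>\<^bsub>G\<^esub> v)}"

definition graph_action ::
    "('g, 'm) monoid_scheme \<Rightarrow> ('a, 'b) pre_digraph \<Rightarrow> ('g \<Rightarrow> 'a \<Rightarrow> 'a) \<Rightarrow> bool" where
  "graph_action C G \<phi> \<longleftrightarrow> group_action C (verts G) \<phi> \<and>
     (\<forall>g\<in>carrier C. \<forall>u\<in>verts G. \<forall>v\<in>verts G. \<phi> g u \<rightarrow>\<^bsub>G\<^esub> \<phi> g v \<longleftrightarrow> u \<rightarrow>\<^bsub>G\<^esub> v)"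

text \<open>
  \<^const>\<open>group_action\<close> requires the maps to be extensional on the set acted on, so passing to a
  subset or to independent sets has to restrict the domain explicitly.
\<close>

definition restrict_action :: "('g \<Rightarrow> 'a \<Rightarrow> 'a) \<Rightarrow> 'a set \<Rightarrow> 'g \<Rightarrow> 'a \<Rightarrow> 'a" where
  "restrict_action \<phi> V = (\<lambda>g. \<lambda>v\<in>V. \<phi> g v)"

definition indep_action ::
    "nat \<Rightarrow> ('a, 'b) pre_digraph \<Rightarrow> ('g \<Rightarrow> 'a \<Rightarrow> 'a) \<Rightarrow> 'g \<Rightarrow> 'a set \<Rightarrow> 'a set" where
  "indep_action k G \<phi> = (\<lambda>g. \<lambda>S\<in>indep_sets k G. \<phi> g ` S)"

definition primitive_root_of_unity :: "nat \<Rightarrow> complex \<Rightarrow> bool" where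
  "primitive_root_of_unity d \<omega> \<longleftrightarrow> d > 0 \<and> \<omega> ^ d = 1 \<and> (\<forall>m. 0 < m \<and> m < d \<longrightarrow> \<omega> ^ m \<noteq> 1)"

text \<open>
  The action \<open>\<psi>\<close> is an explicit argument. The set of fixed points of \<open>g\<close> is
  \<^term>\<open>invariants X \<psi> g\<close>, and \<^term>\<open>group.ord C g\<close> is the order of \<open>g\<close>. Complex coefficients
  subsume polynomials over the naturals, integers and rationals.
\<close>

definition exhibits_CSP ::
    "'x set \<Rightarrow> ('g, 'm) monoid_scheme \<Rightarrow> ('g \<Rightarrow> 'x \<Rightarrow> 'x) \<Rightarrow> complex poly \<Rightarrow> bool" where
  "exhibits_CSP X C \<psi> f \<longleftrightarrow>
     group C \<and> cyclic_group C \<and> finite (carrier C) \<and> finite X \<and> group_action C X \<psi> \<and>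
     (\<forall>g\<in>carrier C. \<forall>\<omega>. primitive_root_of_unity (group.ord C g) \<omega> \<longrightarrow>
        of_nat (card (invariants X \<psi> g)) = poly f \<omega>)"

end

theory Submission
  imports Defs
begin

text \<open>
  An independent \<open>k\<close>-set of \<open>G\<close> either avoids \<open>x\<close>, and then is an independent \<open>k\<close>-set of
  \<open>G \<setminus> x\<close>, or it contains \<open>x\<close>, and then removing \<open>x\<close> leaves an independent \<open>(k - 1)\<close>-set of
  \<open>G \<setminus> N[x]\<close> (\<open>indep_sets_avoiding\<close>, \<open>indep_sets_containing\<close>). As \<open>x\<close> is fixed by the group,
  this decomposition is equivariant: a group element stabilizes \<open>insert x S\<close> exactly when it
  stabilizes \<open>S\<close>. Hence the sets fixed by each group element are counted by the sum of the two
  smaller counts (\<open>card_invariants_indep_action\<close>), and the two sieving polynomials, evaluated at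
  the same root of unity, add up to the required number.
\<close>

text \<open>
  The induced action on independent sets is an instance of the action on any family of subsets
  that the group permutes. Bijectivity on the family comes for free: the image under
  the inverse element is a two-sided inverse.
\<close>

lemma group_action_image:
  assumes act: "group_action C E \<phi>"
    and sub: "F \<subseteq> Pow E"
    and closed: "\<And>g S. g \<in> carrier C \<Longrightarrow> S \<in> F \<Longrightarrow> \<phi> g ` S \<in> F"
  shows "group_action C F (\<lambda>g. \<lambda>S\<in>F. \<phi> g ` S)"
proof -
  interpret group_action C E \<phi> by (rule act)
  interpret C: group C using group_hom group_hom.axioms(1) by blast
  have comp: "\<phi> (g \<otimes>\<^bsub>C\<^esub> h) ` S = \<phi> g ` \<phi> h ` S"
    if "g \<in> carrier C" "h \<in> carrier C" "S \<in> F" for g h S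
  proof -
    have "S \<subseteq> E" using sub that(3) by blast
    then show ?thesis using composition_rule that(1,2) by (force simp: image_image)
  qed
  have one: "\<phi> \<one>\<^bsub>C\<^esub> ` S = S" if "S \<in> F" for S
  proof -
    have "S \<subseteq> E" using sub that by blast
    then have "\<phi> \<one>\<^bsub>C\<^esub> v = v" if "v \<in> S" for v
      using that id_eq_one by (metis restrict_apply' subsetD)
    then show ?thesis by simp
  qed
  have bij: "(\<lambda>S\<in>F. \<phi> g ` S) \<in> Bij F" if g: "g \<in> carrier C" for g
  proof -
    have "bij_betw (\<lambda>S. \<phi> g ` S) F F"
    proof (rule bij_betw_byWitness[where f' = "\<lambda>S. \<phi> (inv\<^bsub>C\<^esub> g) ` S"])
      show "\<forall>S\<in>F. \<phi> (inv\<^bsub>C\<^esub> g) ` \<phi> g ` S = S"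
        using comp[of "inv\<^bsub>C\<^esub> g" g] one g by simp
      show "\<forall>S\<in>F. \<phi> g ` \<phi> (inv\<^bsub>C\<^esub> g) ` S = S"
        using comp[of g "inv\<^bsub>C\<^esub> g"] one g by simp
    qed (use closed g in auto)
    then have "bij_betw (\<lambda>S\<in>F. \<phi> g ` S) F F"
      by (rule bij_betw_cong[THEN iffD1, rotated]) simp
    then show ?thesis by (simp add: Bij_def)
  qed
  have "(\<lambda>g. \<lambda>S\<in>F. \<phi> g ` S) \<in> hom C (BijGroup F)"
  proof (rule homI)
    fix g h assume gh: "g \<in> carrier C" "h \<in> carrier C"
    have "(\<lambda>S\<in>F. \<phi> (g \<otimes>\<^bsub>C\<^esub> h) ` S) = compose F (\<lambda>S\<in>F. \<phi> g ` S) (\<lambda>S\<in>F. \<phi> h ` S)"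
      using comp closed gh by (auto simp: compose_def fun_eq_iff)
    then show "(\<lambda>S\<in>F. \<phi> (g \<otimes>\<^bsub>C\<^esub> h) ` S)
        = (\<lambda>S\<in>F. \<phi> g ` S) \<otimes>\<^bsub>BijGroup F\<^esub> (\<lambda>S\<in>F. \<phi> h ` S)"
      using bij gh by (simp add: BijGroup_def)
  qed (simp add: bij BijGroup_def)
  then show ?thesis
    by (simp add: group_action_def group_hom_def group_hom_axioms_def group_BijGroup C.is_group)
qed

text \<open>
  Injectivity of the vertex maps preserves the size of a set, preservation of adjacency its
  independence.
\<close>

lemma group_action_indep_action:
  assumes "graph_action C G \<phi>"
  shows "group_action C (indep_sets k G) (indep_action k G \<phi>)"
  unfolding indep_action_def
proof (rule group_action_image)
  show act: "group_action C (verts G) \<phi>"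
    using assms by (simp add: graph_action_def)
  show "indep_sets k G \<subseteq> Pow (verts G)" by (auto simp: indep_sets_def)
  fix g S assume g: "g \<in> carrier C" and S: "S \<in> indep_sets k G"
  have sub: "S \<subseteq> verts G" using S by (simp add: indep_sets_def)
  have "inj_on (\<phi> g) S"
    using group_action.inj_prop[OF act g] sub by (rule inj_on_subset)
  then have "card (\<phi> g ` S) = k"
    using S by (simp add: indep_sets_def card_image)
  moreover have "\<phi> g ` S \<subseteq> verts G"
    using group_action.surj_prop[OF act g] sub by blast
  moreover have "\<phi> g u \<rightarrow>\<^bsub>G\<^esub> \<phi> g v \<longleftrightarrow> u \<rightarrow>\<^bsub>G\<^esub> v" if "u \<in> S" "v \<in> S" for u v
    using assms g sub that by (auto simp: graph_action_def)
  ultimately show "\<phi> g ` S \<in> indep_sets k G"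
    using S by (auto simp: indep_sets_def)
qed

lemma verts_delete_verts [simp]: "verts (delete_verts G U) = verts G - U"
  by (simp add: delete_verts_def)

lemma dominates_delete_verts_iff:
  assumes "u \<in> verts G - U" and "v \<in> verts G - U"
  shows "u \<rightarrow>\<^bsub>delete_verts G U\<^esub> v \<longleftrightarrow> u \<rightarrow>\<^bsub>G\<^esub> v"
  using assms by (force simp: delete_verts_def arcs_ends_def arc_to_ends_def)

text \<open>
  Deleting vertices gives an induced subgraph, so independence of a set of surviving vertices
  can be tested in \<open>G\<close>. Both halves of the decomposition are thereby compared within \<open>G\<close>.
\<close>

lemma indep_sets_delete_verts:
  "indep_sets k (delete_verts G U) = {S \<in> indep_sets k G. S \<inter> U = {}}"
proof (rule Set.set_eqI)
  fix S
  have "(\<forall>u\<in>S. \<forall>v\<in>S. \<not> u \<rightarrow>\<^bsub>delete_verts G U\<^esub> v) \<longleftrightarrow> (\<forall>u\<in>S. \<forall>v\<in>S. \<not> u \<rightarrow>\<^bsub>G\<^esub> v)"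
    if "S \<subseteq> verts G - U"
    using that dominates_delete_verts_iff[of _ G U] by (meson subsetD)
  moreover have "S \<subseteq> verts G - U \<longleftrightarrow> S \<subseteq> verts G \<and> S \<inter> U = {}" by blast
  ultimately show "S \<in> indep_sets k (delete_verts G U)
      \<longleftrightarrow> S \<in> {S \<in> indep_sets k G. S \<inter> U = {}}"
    unfolding indep_sets_def verts_delete_verts mem_Collect_eq by argo
qed

lemma indep_sets_avoiding:
  "indep_sets k (delete_verts G {x}) = {S \<in> indep_sets k G. x \<notin> S}"
  by (auto simp: indep_sets_delete_verts)

text \<open>
  The closed neighborhood is defined through arcs into \<open>x\<close> only; symmetry of the graph excludes
  the arcs out of \<open>x\<close> as well, and the absence of loops the arc from \<open>x\<close> to itself. Positivity of
  \<open>k\<close> is essential: for \<open>k = 0\<close> the truncated \<open>k - 1\<close> would let the empty set on the left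
  contribute \<open>{x}\<close>, which has the wrong size.
\<close>

lemma indep_sets_containing:
  assumes "graph G" and x: "x \<in> verts G" and k: "k > 0"
  shows "insert x ` indep_sets (k - 1) (delete_verts G (closed_nbhd G x))
    = {S \<in> indep_sets k G. x \<in> S}"
    (is "?L = ?R")
proof
  interpret graph G by (rule assms(1))
  have sym: "u \<rightarrow>\<^bsub>G\<^esub> v \<Longrightarrow> v \<rightarrow>\<^bsub>G\<^esub> u" for u v
    using sym_arcs by (auto simp: symmetric_def dest: symD)
  have irrefl: "\<not> u \<rightarrow>\<^bsub>G\<^esub> u" for u
    using no_loops by (auto simp: arcs_ends_def arc_to_ends_def)
  show "?L \<subseteq> ?R"
  proof
    fix S assume "S \<in> ?L"
    then obtain T where S: "S = insert x T" and T: "T \<in> indep_sets (k - 1) G"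
      and disj: "T \<inter> closed_nbhd G x = {}"
      by (auto simp: indep_sets_delete_verts)
    have sub: "T \<subseteq> verts G" using T by (simp add: indep_sets_def)
    have xT: "x \<notin> T" using disj by (auto simp: closed_nbhd_def)
    have nonadj: "\<not> v \<rightarrow>\<^bsub>G\<^esub> x" "\<not> x \<rightarrow>\<^bsub>G\<^esub> v" if "v \<in> T" for v
      using that disj sub sym by (auto simp: closed_nbhd_def)
    have "finite T" using sub finite_verts by (rule finite_subset)
    then have "card S = k"
      using T xT k by (simp add: S indep_sets_def)
    then show "S \<in> ?R"
      using T x nonadj irrefl by (auto simp: S indep_sets_def)
  qed
  show "?R \<subseteq> ?L"
  proof
    fix S assume "S \<in> ?R"
    then have S: "S \<in> indep_sets k G" and xS: "x \<in> S" by auto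
    have "card (S - {x}) = k - 1"
      using S xS by (simp add: indep_sets_def)
    then have "S - {x} \<in> indep_sets (k - 1) G"
      using S by (auto simp: indep_sets_def)
    moreover have "(S - {x}) \<inter> closed_nbhd G x = {}"
      using S xS by (auto simp: indep_sets_def closed_nbhd_def)
    ultimately have "S - {x} \<in> indep_sets (k - 1) (delete_verts G (closed_nbhd G x))"
      by (simp add: indep_sets_delete_verts)
    moreover have "S = insert x (S - {x})" using xS by blast
    ultimately show "S \<in> ?L" by blast
  qed
qed

lemma invariants_indep_action:
  "invariants (indep_sets k G) (indep_action k G \<phi>) g = {S \<in> indep_sets k G. \<phi> g ` S = S}"
  by (auto simp: invariants_def indep_action_def)

text \<open>
  Restricting the vertex maps does not change the images of sets of vertices, so fixed points in
  an induced subgraph can be expressed by the original vertex action.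
\<close>

lemma invariants_indep_action_restrict:
  "invariants (indep_sets k G) (indep_action k G (restrict_action \<phi> (verts G))) g
    = {S \<in> indep_sets k G. \<phi> g ` S = S}"
proof -
  have "restrict_action \<phi> (verts G) g ` S = \<phi> g ` S" if "S \<in> indep_sets k G" for S
    using that by (intro image_cong) (auto simp: restrict_action_def indep_sets_def)
  then show ?thesis by (auto simp: invariants_indep_action)
qed

text \<open>
  This is the equivariance of adding the fixed vertex. Injectivity is what keeps \<open>x\<close> out of the
  image of \<open>S\<close>, so that \<open>x\<close> can be cancelled.
\<close>

lemma image_insert_fixed_point_iff:
  assumes "inj_on f (insert x S)" and "f x = x" and "x \<notin> S"
  shows "f ` insert x S = insert x S \<longleftrightarrow> f ` S = S"
proof -
  have "x \<notin> f ` S" using assms by (auto simp: inj_on_def)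
  then show ?thesis using assms(2,3) by (simp add: insert_ident)
qed

lemma card_invariants_indep_action:
  fixes G :: "('a, 'b) pre_digraph" and x :: 'a
  defines "G1 \<equiv> delete_verts G {x}" and "G2 \<equiv> delete_verts G (closed_nbhd G x)"
  assumes "graph G" and x: "x \<in> verts G" and k: "k > 0"
    and inj: "inj_on (\<phi> g) (verts G)" and fix_x: "\<phi> g x = x"
  shows "card (invariants (indep_sets k G) (indep_action k G \<phi>) g)
    = card (invariants (indep_sets k G1) (indep_action k G1 (restrict_action \<phi> (verts G1))) g)
    + card (invariants (indep_sets (k - 1) G2)
        (indep_action (k - 1) G2 (restrict_action \<phi> (verts G2))) g)"
proof -
  interpret graph G by (rule assms(3))
  define A where "A = {S \<in> indep_sets k G1. \<phi> g ` S = S}"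
  define B where "B = {S \<in> indep_sets (k - 1) G2. \<phi> g ` S = S}"
  have sub: "S \<subseteq> verts G" "x \<notin> S" if "S \<in> indep_sets (k - 1) G2" for S
    using that by (auto simp: G2_def indep_sets_def closed_nbhd_def)
  have fixed: "\<phi> g ` insert x S = insert x S \<longleftrightarrow> \<phi> g ` S = S"
    if "S \<in> indep_sets (k - 1) G2" for S
    using sub[OF that] x by (intro image_insert_fixed_point_iff inj_on_subset[OF inj] fix_x) auto
  have "{S \<in> indep_sets k G. \<phi> g ` S = S}
      = A \<union> {S \<in> {S \<in> indep_sets k G. x \<in> S}. \<phi> g ` S = S}"
    by (auto simp: A_def G1_def indep_sets_avoiding)
  also have "{S \<in> {S \<in> indep_sets k G. x \<in> S}. \<phi> g ` S = S} = insert x ` B"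
    unfolding indep_sets_containing[OF assms(3) x k, symmetric] B_def G2_def[symmetric]
    using fixed by blast
  finally have split: "{S \<in> indep_sets k G. \<phi> g ` S = S} = A \<union> insert x ` B" .
  have "finite (indep_sets k G)"
    by (rule finite_subset[of _ "Pow (verts G)"]) (auto simp: indep_sets_def)
  then have fin: "finite (A \<union> insert x ` B)"
    unfolding split[symmetric] by simp
  have disj: "A \<inter> insert x ` B = {}"
    by (auto simp: A_def G1_def indep_sets_avoiding)
  have "inj_on (insert x) B"
    using sub(2) by (auto simp: B_def inj_on_def insert_ident)
  then have "card (A \<union> insert x ` B) = card A + card B"
    using fin disj by (simp add: card_Un_disjoint card_image)
  then show ?thesis
    unfolding invariants_indep_action_restrict unfolding invariants_indep_action split A_def B_def .
qed

theorem lemma4: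
  fixes C :: "('g, 'm) monoid_scheme"
    and G :: "('a, 'b) pre_digraph"
    and \<phi> :: "'g \<Rightarrow> 'a \<Rightarrow> 'a"
    and x :: 'a
    and k :: nat
    and a b :: "complex poly"
  defines "G1 \<equiv> delete_verts G {x}"
    and "G2 \<equiv> delete_verts G (closed_nbhd G x)"
  assumes "group C" and "cyclic_group C" and "finite (carrier C)"
    and "graph G"
    and "graph_action C G \<phi>"
    and "x \<in> verts G" and "\<And>g. g \<in> carrier C \<Longrightarrow> \<phi> g x = x"
    and "k > 0"
    and "exhibits_CSP (indep_sets k G1) C
           (indep_action k G1 (restrict_action \<phi> (verts G1))) a"
    and "exhibits_CSP (indep_sets (k - 1) G2) C
           (indep_action (k - 1) G2 (restrict_action \<phi> (verts G2))) b"
  shows "exhibits_CSP (indep_sets k G) C (indep_action k G \<phi>) (a + b)"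
proof -
  interpret graph G by (rule assms(6))
  have act: "group_action C (verts G) \<phi>"
    using assms(7) by (simp add: graph_action_def)
  have "finite (indep_sets k G)"
    by (rule finite_subset[of _ "Pow (verts G)"]) (auto simp: indep_sets_def)
  moreover have "of_nat (card (invariants (indep_sets k G) (indep_action k G \<phi>) g)) = poly (a + b) \<omega>"
    if "g \<in> carrier C" "primitive_root_of_unity (group.ord C g) \<omega>" for g \<omega>
    using assms(11,12) that
      card_invariants_indep_action[where \<phi> = \<phi> and g = g, OF assms(6,8,10) group_action.inj_prop[OF act that(1)]
        assms(9)[OF that(1)]]
    by (simp add: exhibits_CSP_def G1_def G2_def)
  ultimately show ?thesis
    using assms(3-5) group_action_indep_action[OF assms(7)] by (simp add: exhibits_CSP_def)
qed

end
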